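(* Let $B$ and $X$ be $2$-nilpotent groups, let $\xi\colon B\times X\to X$, $(b,x)\mapsto b\ast x$, be a map, and define a binary operation on the cartesian product $B\times X$ by $$(b,x)\cdot(b',x')=(bb',\,x(b\ast x')).$$ Then $(B\times X,\cdot)$ is a $2$-nilpotent group if and only if the following conditions hold: (1) $\xi$ is a derived action of $B$ on $X$ in the category of groups, that is: (i) $1\ast x=x$; (ii) $(bb')\ast x=b\ast(b'\ast x)$; (iii) $b\ast(xx')=(b\ast x)(b\ast x')$; (2) $(b\ast x)x^{-1}\in \mathrm{Z}(X)\cap X^B$, for any $b,b'\in B$ and $x,x'\in X$, where $X^B=\{x\in X\mid b\ast x=x \text{ for all } b\in B\}$ is the set of fixed points of the action. The resulting $2$-nilpotent group is the semidirect product of $B$ and $X$, denoted by $B\ltimes X$.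
   Context: A group $G$ is called $2$-nilpotent if it is nilpotent of class at most $2$, i.e. its commutator subgroup $[G,G]$ is contained in its center $\mathrm{Z}(G)$. If $\xi$ is a derived action of $B$ on $X$ in the category of groups (conditions (i)–(iii)), then $X^B$ is a subgroup of $X$.
   Formalization: "(B×X,·) is a 2-nilpotent group" is taken to mean with identity element (1,1); with an arbitrary identity the "only if" part fails, e.g. B trivial, X = ℤ, 1∗x = x−1 gives an abelian group with identity (0,1) although (i) fails. *)

theory Defs
  imports "HOL-Algebra.Generated_Groups"
begin

definition center :: "('a, 'm) monoid_scheme \<Rightarrow> 'a set" where
  "center G = {z \<in> carrier G. \<forall>g \<in> carrier G. z \<otimes>\<^bsub>G\<^esub> g = g \<otimes>\<^bsub>G\<^esub> z}"

definition two_nilpotent_group :: "('a, 'm) monoid_scheme \<Rightarrow> bool" where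
  "two_nilpotent_group G \<longleftrightarrow> group G \<and> derived G (carrier G) \<subseteq> center G"

text \<open>Throughout, the map \<open>\<xi> : B \<times> X \<rightarrow> X\<close> is written uncurried, so \<open>\<xi> (b, x)\<close>
  stands for \<open>b * x\<close>.\<close>

definition derived_action ::
  "('b, 'm) monoid_scheme \<Rightarrow> ('x, 'n) monoid_scheme \<Rightarrow> ('b \<times> 'x \<Rightarrow> 'x) \<Rightarrow> bool" where
  "derived_action B X \<xi> \<longleftrightarrow>
     (\<forall>x \<in> carrier X. \<xi> (\<one>\<^bsub>B\<^esub>, x) = x) \<and>
     (\<forall>b \<in> carrier B. \<forall>b' \<in> carrier B. \<forall>x \<in> carrier X.
        \<xi> (b \<otimes>\<^bsub>B\<^esub> b', x) = \<xi> (b, \<xi> (b', x))) \<and>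
     (\<forall>b \<in> carrier B. \<forall>x \<in> carrier X. \<forall>x' \<in> carrier X.
        \<xi> (b, x \<otimes>\<^bsub>X\<^esub> x') = \<xi> (b, x) \<otimes>\<^bsub>X\<^esub> \<xi> (b, x'))"

definition fixed_points ::
  "('b, 'm) monoid_scheme \<Rightarrow> ('x, 'n) monoid_scheme \<Rightarrow> ('b \<times> 'x \<Rightarrow> 'x) \<Rightarrow> 'x set" where
  "fixed_points B X \<xi> = {x \<in> carrier X. \<forall>b \<in> carrier B. \<xi> (b, x) = x}"

text \<open>The unit is part of the structure, as for \<open>DirProd\<close>: it is the pair of units. This
  matters, because the multiplication alone can form a group with a different unit although
  \<open>\<xi>\<close> is not an action: for \<open>B\<close> trivial and \<open>1 * x = c\<^sup>-\<^sup>1 x\<close> with \<open>c \<noteq> 1\<close>, the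
  multiplication is \<open>(1, x) (1, x') = (1, x c\<^sup>-\<^sup>1 x')\<close>, which has unit \<open>(1, c)\<close>.\<close>

definition semidirect_product ::
  "('b, 'm) monoid_scheme \<Rightarrow> ('x, 'n) monoid_scheme \<Rightarrow> ('b \<times> 'x \<Rightarrow> 'x) \<Rightarrow> ('b \<times> 'x) monoid" where
  "semidirect_product B X \<xi> =
     \<lparr>carrier = carrier B \<times> carrier X,
      mult = (\<lambda>(b, x) (b', x'). (b \<otimes>\<^bsub>B\<^esub> b', x \<otimes>\<^bsub>X\<^esub> \<xi> (b, x'))),
      one = (\<one>\<^bsub>B\<^esub>, \<one>\<^bsub>X\<^esub>)\<rparr>"

end

theory Submission
  imports Defs
begin

text \<open>The commutator of \<open>(b, 1)\<close> and \<open>(1, x)\<close> in the semidirect product is \<open>(1, (b * x) x\<^sup>-\<^sup>1)\<close>,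
  and \<open>(1, y)\<close> is central iff \<open>y\<close> is a fixed point in the center of \<open>X\<close>; hence condition (2) is
  necessary. Conversely, under (2) the map \<open>b \<mapsto> (b * x) x\<^sup>-\<^sup>1\<close> is a homomorphism from \<open>B\<close> to the
  abelian group \<open>Z(X)\<close>, so it is trivial on commutators, and \<open>[B, B]\<close> acts trivially on \<open>X\<close>. The
  commutator of \<open>(b, x)\<close> and \<open>(b', x')\<close> is therefore
  \<open>([b, b'], [x, x'] (b * x') x'\<^sup>-\<^sup>1 ((b' * x) x\<^sup>-\<^sup>1)\<^sup>-\<^sup>1)\<close>, whose entries are central, the first
  acting trivially and the second being fixed.\<close>

section \<open>Centers and commutators in a group\<close>

lemma centerI:
  assumes "z \<in> carrier G"
    and "\<And>g. g \<in> carrier G \<Longrightarrow> z \<otimes>\<^bsub>G\<^esub> g = g \<otimes>\<^bsub>G\<^esub> z"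
  shows "z \<in> center G"
  using assms by (simp add: center_def)

lemma center_closed: "z \<in> center G \<Longrightarrow> z \<in> carrier G"
  by (simp add: center_def)

lemma center_commute: "z \<in> center G \<Longrightarrow> g \<in> carrier G \<Longrightarrow> z \<otimes>\<^bsub>G\<^esub> g = g \<otimes>\<^bsub>G\<^esub> z"
  by (simp add: center_def)

context group
begin

lemma inv_commute:
  assumes "z \<in> carrier G" "g \<in> carrier G" "z \<otimes> g = g \<otimes> z"
  shows "inv z \<otimes> g = g \<otimes> inv z"
proof -
  have "z \<otimes> (g \<otimes> inv z) = g"
    using assms by (simp flip: m_assoc) (simp add: m_assoc)
  then show ?thesis
    using assms(1,2) by (metis inv_closed inv_solve_left m_closed)
qed

text \<open>The central \<open>z\<close> moves past \<open>x\<close>. This collects central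
  displacement factors at the front of a product.\<close>

lemma mult_mult_swap:
  assumes "a \<in> carrier G" "x \<in> carrier G" "z \<in> center G" "y \<in> carrier G"
  shows "(a \<otimes> x) \<otimes> (z \<otimes> y) = (a \<otimes> z) \<otimes> (x \<otimes> y)"
proof -
  have z: "z \<in> carrier G" using assms(3) by (rule center_closed)
  have "x \<otimes> (z \<otimes> y) = z \<otimes> (x \<otimes> y)"
    using assms z by (simp flip: m_assoc add: center_commute[of z G x])
  then show ?thesis
    using assms z by (simp add: m_assoc)
qed

lemma subgroup_center: "subgroup (center G) G"
proof (rule subgroupI)
  show "center G \<noteq> {}"
    by (auto simp: center_def intro: exI[of _ \<one>])
next
  fix a assume "a \<in> center G"
  then show "inv a \<in> center G"
    by (auto simp: center_def intro: inv_commute)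
next
  fix a b assume "a \<in> center G" "b \<in> center G"
  then have ab: "a \<in> carrier G" "b \<in> carrier G"
    and comm: "\<And>g. g \<in> carrier G \<Longrightarrow> a \<otimes> g = g \<otimes> a" "\<And>g. g \<in> carrier G \<Longrightarrow> b \<otimes> g = g \<otimes> b"
    by (auto simp: center_def)
  show "a \<otimes> b \<in> center G"
  proof (rule centerI)
    fix g assume g: "g \<in> carrier G"
    have "a \<otimes> b \<otimes> g = a \<otimes> (g \<otimes> b)"
      using ab g by (simp add: m_assoc comm(2)[OF g])
    also have "\<dots> = g \<otimes> a \<otimes> b"
      using ab g by (simp flip: m_assoc add: comm(1)[OF g])
    finally show "a \<otimes> b \<otimes> g = g \<otimes> (a \<otimes> b)"
      using ab g by (simp add: m_assoc)
  qed (use ab in simp)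
qed (auto simp: center_def)

text \<open>The \<open>z\<close> on the right is the commutator of \<open>g\<close> and
  \<open>h\<close>; since the center is a subgroup, it suffices to place these generators in it.
  This form mentions only products, so no inverses in the semidirect product need computing
  later.\<close>

lemma derived_le_center_iff:
  "derived G (carrier G) \<subseteq> center G \<longleftrightarrow>
     (\<forall>g \<in> carrier G. \<forall>h \<in> carrier G. \<exists>z \<in> center G. g \<otimes> h = z \<otimes> (h \<otimes> g))"
    (is "?L \<longleftrightarrow> ?R")
proof
  assume ?L
  show ?R
  proof (intro ballI)
    fix g h assume gh: "g \<in> carrier G" "h \<in> carrier G"
    then have "g \<otimes> h \<otimes> inv g \<otimes> inv h \<in> derived G (carrier G)"
      unfolding derived_def by (blast intro: generate.incl)
    moreover have "g \<otimes> h = g \<otimes> h \<otimes> inv g \<otimes> inv h \<otimes> (h \<otimes> g)"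
      using gh by (simp add: m_assoc inv_solve_left')
    ultimately show "\<exists>z \<in> center G. g \<otimes> h = z \<otimes> (h \<otimes> g)"
      using \<open>?L\<close> by blast
  qed
next
  assume R: ?R
  have "g \<otimes> h \<otimes> inv g \<otimes> inv h \<in> center G" if gh: "g \<in> carrier G" "h \<in> carrier G" for g h
  proof -
    obtain z where z: "z \<in> center G" "g \<otimes> h = z \<otimes> (h \<otimes> g)"
      using R gh by blast
    then have "g \<otimes> h \<otimes> inv g \<otimes> inv h = z"
      using gh center_closed[OF z(1)] by (simp add: m_assoc)
    then show ?thesis using z by simp
  qed
  then show ?L
    unfolding derived_def by (intro generate_subgroup_incl subgroup_center) auto
qed

end

lemma two_nilpotent_group_iff:
  "two_nilpotent_group G \<longleftrightarrow> group G \<and>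
     (\<forall>g \<in> carrier G. \<forall>h \<in> carrier G. \<exists>z \<in> center G. g \<otimes>\<^bsub>G\<^esub> h = z \<otimes>\<^bsub>G\<^esub> (h \<otimes>\<^bsub>G\<^esub> g))"
  unfolding two_nilpotent_group_def using group.derived_le_center_iff by blast

section \<open>The product structure and what its group laws say about \<open>\<xi>\<close>\<close>

lemma semidirect_product_simps [simp]:
  "carrier (semidirect_product B X \<xi>) = carrier B \<times> carrier X"
  "(b, x) \<otimes>\<^bsub>semidirect_product B X \<xi>\<^esub> (b', x') = (b \<otimes>\<^bsub>B\<^esub> b', x \<otimes>\<^bsub>X\<^esub> \<xi> (b, x'))"
  "\<one>\<^bsub>semidirect_product B X \<xi>\<^esub> = (\<one>\<^bsub>B\<^esub>, \<one>\<^bsub>X\<^esub>)"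
  by (simp_all add: semidirect_product_def)

locale group_operation = B: group B + X: group X
  for B :: "('b, 'm) monoid_scheme" and X :: "('x, 'n) monoid_scheme" +
  fixes \<xi> :: "'b \<times> 'x \<Rightarrow> 'x"
  assumes op_funcset: "\<xi> \<in> carrier B \<times> carrier X \<rightarrow> carrier X"
begin

abbreviation S where "S \<equiv> semidirect_product B X \<xi>"

abbreviation disp where "disp b x \<equiv> \<xi> (b, x) \<otimes>\<^bsub>X\<^esub> inv\<^bsub>X\<^esub> x"

lemma op_closed [simp]: "b \<in> carrier B \<Longrightarrow> x \<in> carrier X \<Longrightarrow> \<xi> (b, x) \<in> carrier X"
  using op_funcset by blast

text \<open>The left unit law at \<open>(1, x)\<close> gives (i) and the right unit law at
  \<open>(b, 1)\<close> gives \<open>b * 1 = 1\<close>. Associativity gives a mixed law that becomes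
  (ii) when the inner factor from \<open>X\<close> is 1, and (iii) when
  \<open>b' = 1\<close>.\<close>

lemma derived_action_if_group:
  assumes "group S"
  shows "derived_action B X \<xi>"
proof -
  interpret S: group S by fact
  have one: "\<xi> (\<one>\<^bsub>B\<^esub>, x) = x" if "x \<in> carrier X" for x
    using S.l_one[of "(\<one>\<^bsub>B\<^esub>, x)"] that by simp
  have op_one: "\<xi> (b, \<one>\<^bsub>X\<^esub>) = \<one>\<^bsub>X\<^esub>" if "b \<in> carrier B" for b
    using S.r_one[of "(b, \<one>\<^bsub>X\<^esub>)"] that by simp
  have assoc: "\<xi> (b, x \<otimes>\<^bsub>X\<^esub> \<xi> (b', x')) = \<xi> (b, x) \<otimes>\<^bsub>X\<^esub> \<xi> (b \<otimes>\<^bsub>B\<^esub> b', x')"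
    if "b \<in> carrier B" "b' \<in> carrier B" "x \<in> carrier X" "x' \<in> carrier X" for b b' x x'
    using S.m_assoc[of "(b, \<one>\<^bsub>X\<^esub>)" "(b', x)" "(\<one>\<^bsub>B\<^esub>, x')"]
      S.m_assoc[of "(b, \<one>\<^bsub>X\<^esub>)" "(b', x)" "(b', x')"] that by simp
  show ?thesis
    unfolding derived_action_def
    using one op_one assoc[of _ _ "\<one>\<^bsub>X\<^esub>"] assoc[of _ "\<one>\<^bsub>B\<^esub>"] by simp
qed

end

section \<open>Derived actions, and the necessity of condition (2)\<close>

locale group_action_by_automorphisms = group_operation +
  assumes derived_action: "derived_action B X \<xi>"
begin

lemma op_one_left [simp]: "x \<in> carrier X \<Longrightarrow> \<xi> (\<one>\<^bsub>B\<^esub>, x) = x"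
  and op_mult_left: "\<lbrakk>b \<in> carrier B; b' \<in> carrier B; x \<in> carrier X\<rbrakk>
    \<Longrightarrow> \<xi> (b \<otimes>\<^bsub>B\<^esub> b', x) = \<xi> (b, \<xi> (b', x))"
  and op_mult_right: "\<lbrakk>b \<in> carrier B; x \<in> carrier X; x' \<in> carrier X\<rbrakk>
    \<Longrightarrow> \<xi> (b, x \<otimes>\<^bsub>X\<^esub> x') = \<xi> (b, x) \<otimes>\<^bsub>X\<^esub> \<xi> (b, x')"
  using derived_action by (auto simp: derived_action_def)

lemma op_one_right [simp]: "b \<in> carrier B \<Longrightarrow> \<xi> (b, \<one>\<^bsub>X\<^esub>) = \<one>\<^bsub>X\<^esub>"
  using op_mult_right[of b "\<one>\<^bsub>X\<^esub>" "\<one>\<^bsub>X\<^esub>"] by simp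

lemma group_semidirect_product: "group S"
proof (rule groupI)
  fix p assume "p \<in> carrier S"
  then obtain b x where p: "p = (b, x)" "b \<in> carrier B" "x \<in> carrier X" by auto
  \<comment> \<open>A left inverse is enough: by (iii) the second entry of \<open>?q\<close> times
    \<open>p\<close> is the inverse of \<open>b\<close> acting on the product of the inverse of
    \<open>x\<close> with \<open>x\<close>, hence 1.\<close>
  let ?q = "(inv\<^bsub>B\<^esub> b, \<xi> (inv\<^bsub>B\<^esub> b, inv\<^bsub>X\<^esub> x))"
  have "?q \<otimes>\<^bsub>S\<^esub> p = \<one>\<^bsub>S\<^esub>"
    using p by (simp flip: op_mult_right)
  then show "\<exists>q \<in> carrier S. q \<otimes>\<^bsub>S\<^esub> p = \<one>\<^bsub>S\<^esub>"
    using p by (intro bexI[of _ ?q]) auto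
qed (auto simp: B.m_assoc X.m_assoc op_mult_left op_mult_right)

lemma subgroup_fixed_points: "subgroup (fixed_points B X \<xi>) X"
proof (rule X.subgroupI)
  fix x assume "x \<in> fixed_points B X \<xi>"
  then have x: "x \<in> carrier X" "\<And>b. b \<in> carrier B \<Longrightarrow> \<xi> (b, x) = x"
    by (auto simp: fixed_points_def)
  have "\<xi> (b, inv\<^bsub>X\<^esub> x) = inv\<^bsub>X\<^esub> x" if "b \<in> carrier B" for b
  proof -
    have "\<xi> (b, inv\<^bsub>X\<^esub> x) \<otimes>\<^bsub>X\<^esub> x = \<one>\<^bsub>X\<^esub>"
      using op_mult_right[of b "inv\<^bsub>X\<^esub> x" x] x that by simp
    then show ?thesis
      using x(1) that by (intro X.inv_equality[symmetric]) simp_all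
  qed
  then show "inv\<^bsub>X\<^esub> x \<in> fixed_points B X \<xi>"
    using x by (simp add: fixed_points_def)
qed (auto simp: fixed_points_def op_mult_right intro: exI[of _ "\<one>\<^bsub>X\<^esub>"])

lemma disp_central_if_two_nilpotent:
  assumes "two_nilpotent_group S" "b \<in> carrier B" "x \<in> carrier X"
  shows "disp b x \<in> center X \<inter> fixed_points B X \<xi>"
proof -
  obtain z where z: "z \<in> center S"
    "(b, \<one>\<^bsub>X\<^esub>) \<otimes>\<^bsub>S\<^esub> (\<one>\<^bsub>B\<^esub>, x) = z \<otimes>\<^bsub>S\<^esub> ((\<one>\<^bsub>B\<^esub>, x) \<otimes>\<^bsub>S\<^esub> (b, \<one>\<^bsub>X\<^esub>))"
    using assms unfolding two_nilpotent_group_iff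
    by (metis B.one_closed X.one_closed mem_Sigma_iff semidirect_product_simps(1))
  obtain c y where cy: "z = (c, y)" by force
  have closed: "c \<in> carrier B" "y \<in> carrier X" using center_closed[OF z(1)] cy by auto
  \<comment> \<open>The two products are \<open>(b, b * x)\<close> and \<open>(b, x)\<close>. The
    first entries force \<open>c = 1\<close>, after which the second ones determine
    \<open>y\<close>.\<close>
  from z(2) cy closed assms have "c \<otimes>\<^bsub>B\<^esub> b = b" "\<xi> (b, x) = y \<otimes>\<^bsub>X\<^esub> \<xi> (c, x)"
    by auto
  then have c: "c = \<one>\<^bsub>B\<^esub>" and y: "y = disp b x"
    using closed assms by (auto simp: B.r_cancel_one X.m_assoc)
  \<comment> \<open>Commuting with the elements \<open>(1, g)\<close> makes \<open>y\<close> central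
    in \<open>X\<close>; commuting with the elements \<open>(b', 1)\<close> makes it a fixed
    point.\<close>
  have "y \<otimes>\<^bsub>X\<^esub> g = g \<otimes>\<^bsub>X\<^esub> y" if "g \<in> carrier X" for g
    using center_commute[OF z(1), of "(\<one>\<^bsub>B\<^esub>, g)"] cy c closed that by simp
  moreover have "\<xi> (b', y) = y" if "b' \<in> carrier B" for b'
    using center_commute[OF z(1), of "(b', \<one>\<^bsub>X\<^esub>)"] cy c closed that by simp
  ultimately show ?thesis
    using closed unfolding y[symmetric] by (auto simp: fixed_points_def intro: centerI)
qed

end

section \<open>Sufficiency of condition (2)\<close>

locale central_displacement = group_action_by_automorphisms +
  assumes disp: "\<lbrakk>b \<in> carrier B; x \<in> carrier X\<rbrakk> \<Longrightarrow> disp b x \<in> center X \<inter> fixed_points B X \<xi>"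
begin

lemma op_eq_disp: "b \<in> carrier B \<Longrightarrow> x \<in> carrier X \<Longrightarrow> \<xi> (b, x) = disp b x \<otimes>\<^bsub>X\<^esub> x"
  by (simp add: X.m_assoc)

text \<open>Acting by \<open>b\<close> on \<open>b' * x = disp b' x \<otimes> x\<close> leaves the
  fixed factor \<open>disp b' x\<close> alone and displaces only \<open>x\<close>, so displacements
  multiply.\<close>

lemma op_mult_left_disp:
  assumes "b \<in> carrier B" "b' \<in> carrier B" "x \<in> carrier X"
  shows "\<xi> (b \<otimes>\<^bsub>B\<^esub> b', x) = disp b' x \<otimes>\<^bsub>X\<^esub> (disp b x \<otimes>\<^bsub>X\<^esub> x)"
proof -
  have "\<xi> (b \<otimes>\<^bsub>B\<^esub> b', x) = \<xi> (b, disp b' x \<otimes>\<^bsub>X\<^esub> x)"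
    using assms by (simp add: op_mult_left flip: op_eq_disp)
  also have "\<dots> = \<xi> (b, disp b' x) \<otimes>\<^bsub>X\<^esub> \<xi> (b, x)"
    using assms by (intro op_mult_right) auto
  also have "\<dots> = disp b' x \<otimes>\<^bsub>X\<^esub> \<xi> (b, x)"
    using disp[of b' x] assms by (simp add: fixed_points_def)
  finally show ?thesis using op_eq_disp assms by simp
qed

text \<open>Both sides multiply \<open>x\<close> by the same two displacements, which commute
  because they are central.\<close>

lemma op_commute:
  assumes "b \<in> carrier B" "b' \<in> carrier B" "x \<in> carrier X"
  shows "\<xi> (b \<otimes>\<^bsub>B\<^esub> b', x) = \<xi> (b' \<otimes>\<^bsub>B\<^esub> b, x)"
proof -
  have "d' \<otimes>\<^bsub>X\<^esub> (d \<otimes>\<^bsub>X\<^esub> x) = d \<otimes>\<^bsub>X\<^esub> (d' \<otimes>\<^bsub>X\<^esub> x)"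
    if "d \<in> center X" "d' \<in> carrier X" for d d'
    using that assms(3) center_closed[OF that(1)] by (simp add: center_commute flip: X.m_assoc)
  then have "disp b' x \<otimes>\<^bsub>X\<^esub> (disp b x \<otimes>\<^bsub>X\<^esub> x) = disp b x \<otimes>\<^bsub>X\<^esub> (disp b' x \<otimes>\<^bsub>X\<^esub> x)"
    using assms disp[of b x] by simp
  then show ?thesis
    using assms by (simp only: op_mult_left_disp)
qed

text \<open>Here \<open>c\<close> is the commutator of \<open>b\<close> and \<open>b'\<close>. Since
  \<open>bb'\<close> and \<open>b'b\<close> act alike, \<open>c\<close> fixes everything of the form
  \<open>b'b * y\<close>, and every element of \<open>X\<close> has this form.\<close>

lemma op_commutator:
  assumes "b \<in> carrier B" "b' \<in> carrier B" "c \<in> carrier B" "x \<in> carrier X"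
    and c: "b \<otimes>\<^bsub>B\<^esub> b' = c \<otimes>\<^bsub>B\<^esub> (b' \<otimes>\<^bsub>B\<^esub> b)"
  shows "\<xi> (c, x) = x"
proof -
  let ?d = "b' \<otimes>\<^bsub>B\<^esub> b"
  define y where "y = \<xi> (inv\<^bsub>B\<^esub> ?d, x)"
  have y: "y \<in> carrier X" "\<xi> (?d, y) = x"
    using assms by (simp_all add: y_def flip: op_mult_left)
  have "\<xi> (c, \<xi> (?d, y)) = \<xi> (?d, y)"
    using op_commute[of b b' y] assms y by (simp add: c op_mult_left[of c ?d])
  then show ?thesis using y by simp
qed

text \<open>Here \<open>z\<close> is the commutator of \<open>x\<close> and \<open>x'\<close>.
  Acting by \<open>b\<close> multiplies both \<open>xx'\<close> and \<open>x'x\<close> by the same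
  central element \<open>dd'\<close>, which therefore cancels when the images are compared.\<close>

lemma fixed_commutator:
  assumes "x \<in> carrier X" "x' \<in> carrier X"
    and z: "z \<in> center X" and comm: "x \<otimes>\<^bsub>X\<^esub> x' = z \<otimes>\<^bsub>X\<^esub> (x' \<otimes>\<^bsub>X\<^esub> x)"
  shows "z \<in> fixed_points B X \<xi>"
proof -
  have zc: "z \<in> carrier X" using z by (rule center_closed)
  have "\<xi> (b, z) = z" if b: "b \<in> carrier B" for b
  proof -
    define d d' where "d = disp b x" and "d' = disp b x'"
    have d: "d \<in> carrier X" "d' \<in> carrier X" "\<xi> (b, x) = d \<otimes>\<^bsub>X\<^esub> x" "\<xi> (b, x') = d' \<otimes>\<^bsub>X\<^esub> x'"
      using assms b by (simp_all add: d_def d'_def flip: op_eq_disp)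
    have dc: "d \<in> center X" "d' \<in> center X"
      using disp assms b by (auto simp: d_def d'_def)
    have swap: "\<xi> (b, x \<otimes>\<^bsub>X\<^esub> x') = (d \<otimes>\<^bsub>X\<^esub> d') \<otimes>\<^bsub>X\<^esub> (x \<otimes>\<^bsub>X\<^esub> x')"
      "\<xi> (b, x' \<otimes>\<^bsub>X\<^esub> x) = (d \<otimes>\<^bsub>X\<^esub> d') \<otimes>\<^bsub>X\<^esub> (x' \<otimes>\<^bsub>X\<^esub> x)"
      using d dc assms(1,2) b X.mult_mult_swap[of d x d' x'] X.mult_mult_swap[of d' x' d x]
        center_commute[of d X d'] by (simp_all add: op_mult_right)
    have "\<xi> (b, z) \<otimes>\<^bsub>X\<^esub> \<xi> (b, x' \<otimes>\<^bsub>X\<^esub> x) = \<xi> (b, x \<otimes>\<^bsub>X\<^esub> x')"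
      using assms zc b by (simp add: comm op_mult_right)
    also have "\<dots> = (d \<otimes>\<^bsub>X\<^esub> d') \<otimes>\<^bsub>X\<^esub> z \<otimes>\<^bsub>X\<^esub> (x' \<otimes>\<^bsub>X\<^esub> x)"
      unfolding swap using assms zc d by (simp add: comm X.m_assoc)
    also have "\<dots> = z \<otimes>\<^bsub>X\<^esub> \<xi> (b, x' \<otimes>\<^bsub>X\<^esub> x)"
      unfolding swap using assms zc d center_commute[OF z, of "d \<otimes>\<^bsub>X\<^esub> d'"] by (simp flip: X.m_assoc)
    finally show ?thesis
      using assms zc b X.right_cancel[of "\<xi> (b, x' \<otimes>\<^bsub>X\<^esub> x)" "\<xi> (b, z)" z] by simp
  qed
  then show ?thesis using zc by (simp add: fixed_points_def)
qed

text \<open>Since \<open>c\<close> acts trivially and \<open>z\<close> is fixed, no action is left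
  in either product of \<open>(c, z)\<close> with \<open>(b, x)\<close>: the entries are just
  \<open>cb\<close>, \<open>zx\<close> and \<open>bc\<close>, \<open>xz\<close>.\<close>

lemma center_semidirect_productI:
  assumes "c \<in> center B" "\<And>x. x \<in> carrier X \<Longrightarrow> \<xi> (c, x) = x"
    and "z \<in> center X \<inter> fixed_points B X \<xi>"
  shows "(c, z) \<in> center S"
  using assms by (auto simp: center_def fixed_points_def)

lemma two_nilpotent_semidirect_product:
  assumes "two_nilpotent_group B" "two_nilpotent_group X"
  shows "two_nilpotent_group S"
  unfolding two_nilpotent_group_iff
proof (intro conjI ballI group_semidirect_product)
  fix p p' assume "p \<in> carrier S" "p' \<in> carrier S"
  then obtain b x b' x' where p: "p = (b, x)" "p' = (b', x')"
    and cl: "b \<in> carrier B" "b' \<in> carrier B" "x \<in> carrier X" "x' \<in> carrier X"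
    by auto
  obtain c where c: "c \<in> center B" "b \<otimes>\<^bsub>B\<^esub> b' = c \<otimes>\<^bsub>B\<^esub> (b' \<otimes>\<^bsub>B\<^esub> b)"
    using assms(1) cl unfolding two_nilpotent_group_iff by blast
  obtain k where k: "k \<in> center X" "x \<otimes>\<^bsub>X\<^esub> x' = k \<otimes>\<^bsub>X\<^esub> (x' \<otimes>\<^bsub>X\<^esub> x)"
    using assms(2) cl unfolding two_nilpotent_group_iff by blast
  define e e' where "e = disp b x'" and "e' = disp b' x"
  have e: "e \<in> center X \<inter> fixed_points B X \<xi>" "e' \<in> center X \<inter> fixed_points B X \<xi>"
    using disp cl by (simp_all add: e_def e'_def)
  have eq: "\<xi> (b, x') = e \<otimes>\<^bsub>X\<^esub> x'" "\<xi> (b', x) = e' \<otimes>\<^bsub>X\<^esub> x"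
    using cl by (simp_all add: e_def e'_def flip: op_eq_disp)
  \<comment> \<open>The second entries of \<open>pp'\<close> and \<open>p'p\<close> are
    \<open>x e x'\<close> and \<open>x' e' x\<close>. With the central factors in front these are
    \<open>k e x'x\<close> and \<open>e' x'x\<close>, which determines \<open>z\<close>.\<close>
  define z where "z = k \<otimes>\<^bsub>X\<^esub> (e \<otimes>\<^bsub>X\<^esub> inv\<^bsub>X\<^esub> e')"
  have sub: "subgroup (center X \<inter> fixed_points B X \<xi>) X"
    using X.subgroup_center subgroup_fixed_points by (rule X.subgroups_Inter_pair)
  have "k \<in> center X \<inter> fixed_points B X \<xi>"
    using fixed_commutator[OF cl(3,4) k] k by simp
  then have z: "z \<in> center X \<inter> fixed_points B X \<xi>"
    unfolding z_def by (intro subgroup.m_closed[OF sub] subgroup.m_inv_closed[OF sub] e)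
  have Xcl: "k \<in> carrier X" "e \<in> carrier X" "e' \<in> carrier X" "z \<in> carrier X" "c \<in> carrier B"
    using k e z c by (auto dest: center_closed)
  \<comment> \<open>Triviality of the action of \<open>c\<close> serves twice: for the centrality of
    \<open>(c, z)\<close>, and to make the second entry of \<open>(c, z)\<close> times
    \<open>p'p\<close> plain multiplication by \<open>z\<close>.\<close>
  have triv: "\<xi> (c, y) = y" if "y \<in> carrier X" for y
    using op_commutator[of b b' c y] cl Xcl c that by simp
  have com: "g \<otimes>\<^bsub>X\<^esub> e = e \<otimes>\<^bsub>X\<^esub> g" "g \<otimes>\<^bsub>X\<^esub> e' = e' \<otimes>\<^bsub>X\<^esub> g" if "g \<in> carrier X" for g
    using e that center_commute[of e X g] center_commute[of e' X g] by simp_all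
  have swap: "x' \<otimes>\<^bsub>X\<^esub> (e' \<otimes>\<^bsub>X\<^esub> x) = e' \<otimes>\<^bsub>X\<^esub> (x' \<otimes>\<^bsub>X\<^esub> x)"
    using cl Xcl com(2)[of x'] by (simp flip: X.m_assoc)
  have "x \<otimes>\<^bsub>X\<^esub> (e \<otimes>\<^bsub>X\<^esub> x') = e \<otimes>\<^bsub>X\<^esub> (x \<otimes>\<^bsub>X\<^esub> x')"
    using cl Xcl com(1)[of x] by (simp flip: X.m_assoc)
  also have "\<dots> = k \<otimes>\<^bsub>X\<^esub> e \<otimes>\<^bsub>X\<^esub> (x' \<otimes>\<^bsub>X\<^esub> x)"
    unfolding k(2) using cl Xcl com(1)[of k] by (simp flip: X.m_assoc)
  also have "\<dots> = z \<otimes>\<^bsub>X\<^esub> e' \<otimes>\<^bsub>X\<^esub> (x' \<otimes>\<^bsub>X\<^esub> x)"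
    using cl Xcl by (simp add: z_def X.m_assoc)
  also have "\<dots> = z \<otimes>\<^bsub>X\<^esub> (x' \<otimes>\<^bsub>X\<^esub> (e' \<otimes>\<^bsub>X\<^esub> x))"
    using cl Xcl by (simp add: X.m_assoc swap)
  finally have "p \<otimes>\<^bsub>S\<^esub> p' = (c, z) \<otimes>\<^bsub>S\<^esub> (p' \<otimes>\<^bsub>S\<^esub> p)"
    using cl Xcl c(2) by (simp add: p eq triv)
  then show "\<exists>z \<in> center S. p \<otimes>\<^bsub>S\<^esub> p' = z \<otimes>\<^bsub>S\<^esub> (p' \<otimes>\<^bsub>S\<^esub> p)"
    using center_semidirect_productI[OF c(1) triv z] by blast
qed

end

theorem proposition2p4:
  fixes B :: "('b, 'm) monoid_scheme"
    and X :: "('x, 'n) monoid_scheme"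
    and \<xi> :: "'b \<times> 'x \<Rightarrow> 'x"
  assumes "two_nilpotent_group B"
    and "two_nilpotent_group X"
    and "\<xi> \<in> carrier B \<times> carrier X \<rightarrow> carrier X"
  shows "two_nilpotent_group (semidirect_product B X \<xi>) \<longleftrightarrow>
           derived_action B X \<xi> \<and>
           (\<forall>b \<in> carrier B. \<forall>x \<in> carrier X.
              \<xi> (b, x) \<otimes>\<^bsub>X\<^esub> inv\<^bsub>X\<^esub> x \<in> center X \<inter> fixed_points B X \<xi>)"
    (is "?N \<longleftrightarrow> ?A \<and> ?C")
proof -
  interpret group_operation B X \<xi>
    using assms
    by (simp add: group_operation_def group_operation_axioms_def two_nilpotent_group_def)
  show ?thesis
  proof (intro iffI conjI)
    assume ?N
    then show A: ?A
      by (simp add: derived_action_if_group two_nilpotent_group_def)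
    \<comment> \<open>Condition (1) is established first because the commutator computation behind
      (2) already uses the action laws.\<close>
    interpret group_action_by_automorphisms B X \<xi>
      using A by unfold_locales
    from \<open>?N\<close> show ?C
      by (intro ballI disp_central_if_two_nilpotent)
  next
    assume "?A \<and> ?C"
    then interpret central_displacement B X \<xi>
      by unfold_locales auto
    show ?N
      using assms by (intro two_nilpotent_semidirect_product)
  qed
qed

end
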